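(* Let $m,n\ge 1$ be integers. For any $2m$-dimensional hypermatrix $A=(a_{i_1,\ldots,i_{2m}})_{1\le i_1,\ldots,i_{2m}\le n}$ with commuting entries one has $$\lim_{\lambda\to 1}\mathrm{det}^{[2m]}_{\lambda}(A)=\mathrm{det}^{[2m]}(A),$$ where $\mathrm{det}^{[2m]}_{\lambda}$ is the $\lambda$-hyperdeterminant and $\mathrm{det}^{[2m]}$ is Cayley's second hyperdeterminant.
   Context: Write $A(i_1,\dots,i_{2m})=a_{i_1,\dots,i_{2m}}$. The entries commute and do not depend on the parameter $\lambda$; $\mathrm{det}^{[2m]}_\lambda(A)$ is a polynomial in the entries whose coefficients are rational functions of $\lambda$, and the limit is taken coefficientwise with the entries fixed. Cayley's second hyperdeterminant: $$\mathrm{det}^{[2m]}(A)=\frac{1}{n!}\sum_{\sigma_1,\dots,\sigma_{2m}\in\mathfrak S_n}\ \prod_{i=1}^{2m}\operatorname{sgn}(\sigma_i)\ \prod_{i=1}^n A(\sigma_1(i),\dots,\sigma_{2m}(i)).$$ Alternating sign matrices: $\mathrm{Alt}_n$ is the set of $n\times n$ matrices with entries in $\{0,1,-1\}$ such that each row and each column sums to $1$ and the nonzero entries in each row and each column alternate in sign. For $X=(x_{ij})\in\mathrm{Alt}_n$: - the inversion number is $i(X)=\sum x_{ij}x_{rs}$, summed over all $1\le i,j,r,s\le n$ with $r>i$ and $s<j$; - $n(X)$ is the number of entries of $X$ equal to $-1$; - $X(i)=\sum_{j=1}^n j\,x_{ij}$ for $1\le i\le n$ (the generalized permutation of $X$);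 one always has $1\le X(i)\le n$. Also $(a;q)_n=(1-a)(1-aq)\cdots(1-aq^{n-1})$, and $0^0=1$ by convention. The $\lambda$-hyperdeterminant of a $2m$-dimensional hypermatrix $M=(M(i_1,\dots,i_{2m}))_{1\le i_1,\dots,i_{2m}\le n}$ is $$\mathrm{det}^{[2m]}_{\lambda}(M)=\frac{(1-\lambda)^n}{(\lambda;\lambda)_n}\sum_{X_1,\dots,X_{2m}\in\mathrm{Alt}_n}\phi_\lambda(X_1,\dots,X_{2m})\prod_{i=1}^n M(X_1(i),X_2(i),\dots,X_{2m}(i)),$$ where $$\phi_\lambda(X_1,\dots,X_{2m})=\prod_{r=1}^m(-\lambda^{r-1})^{i(X_r)}(1-\lambda^{-(r-1)})^{n(X_r)}(-\lambda^{r})^{i(X_{m+r})}(1-\lambda^{-r})^{n(X_{m+r})}.$$ *)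

theory Defs
  imports "HOL-Analysis.Analysis" "HOL-Combinatorics.Combinatorics"
    "HOL-Computational_Algebra.Polynomial" "HOL-Library.Multiset"
begin

text \<open>An \<open>n \<times> n\<close> integer matrix is a function on pairs of indices in \<open>{1..n}\<close>, extended by zero
  outside this range so that distinct functions are distinct matrices.\<close>

definition alternating_on :: "nat \<Rightarrow> (nat \<Rightarrow> int) \<Rightarrow> bool" where
  "alternating_on n v \<longleftrightarrow>
     (\<forall>j\<in>{1..n}. \<forall>k\<in>{1..n}. j < k \<longrightarrow> v j \<noteq> 0 \<longrightarrow> v k \<noteq> 0 \<longrightarrow> (\<forall>l\<in>{j<..<k}. v l = 0)
        \<longrightarrow> v k = - v j)"

definition Alt :: "nat \<Rightarrow> (nat \<Rightarrow> nat \<Rightarrow> int) set" where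
  "Alt n = {x.
     (\<forall>i\<in>{1..n}. \<forall>j\<in>{1..n}. x i j \<in> {0, 1, -1}) \<and>
     (\<forall>i j. \<not> (i \<in> {1..n} \<and> j \<in> {1..n}) \<longrightarrow> x i j = 0) \<and>
     (\<forall>i\<in>{1..n}. (\<Sum>j=1..n. x i j) = 1) \<and>
     (\<forall>j\<in>{1..n}. (\<Sum>i=1..n. x i j) = 1) \<and>
     (\<forall>i\<in>{1..n}. alternating_on n (\<lambda>j. x i j)) \<and>
     (\<forall>j\<in>{1..n}. alternating_on n (\<lambda>i. x i j))}"

definition inv_number :: "nat \<Rightarrow> (nat \<Rightarrow> nat \<Rightarrow> int) \<Rightarrow> int" where
  "inv_number n x = (\<Sum>i=1..n. \<Sum>j=1..n. \<Sum>r\<in>{i<..n}. \<Sum>s\<in>{1..<j}. x i j * x r s)"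

definition neg_count :: "nat \<Rightarrow> (nat \<Rightarrow> nat \<Rightarrow> int) \<Rightarrow> nat" where
  "neg_count n x = card {(i, j). i \<in> {1..n} \<and> j \<in> {1..n} \<and> x i j = -1}"

text \<open>For \<open>x \<in> Alt n\<close> and \<open>i \<in> {1..n}\<close> the sum lies in \<open>{1..n}\<close>, so \<open>nat\<close> does not truncate.\<close>

definition gen_perm :: "nat \<Rightarrow> (nat \<Rightarrow> nat \<Rightarrow> int) \<Rightarrow> nat \<Rightarrow> nat" where
  "gen_perm n x i = nat (\<Sum>j=1..n. int j * x i j)"

definition qpoch :: "'k::comm_ring_1 \<Rightarrow> 'k \<Rightarrow> nat \<Rightarrow> 'k" where
  "qpoch a q n = (\<Prod>k<n. 1 - a * q ^ k)"

definition phi :: "nat \<Rightarrow> nat \<Rightarrow> 'k::field \<Rightarrow> (nat \<Rightarrow> nat \<Rightarrow> nat \<Rightarrow> int) \<Rightarrow> 'k" where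
  "phi m n q X = (\<Prod>r=1..m.
       (- (q ^ (r - 1))) powi inv_number n (X r)
     * (1 - q powi (- (int r - 1))) ^ neg_count n (X r)
     * (- (q ^ r)) powi inv_number n (X (m + r))
     * (1 - q powi (- int r)) ^ neg_count n (X (m + r)))"

text \<open>A \<open>2m\<close>-dimensional hypermatrix is a function \<open>A\<close> on multi-indices, represented as lists;
  only its values on \<open>multi_indices m n\<close> matter. The entries lie in a commutative algebra \<open>'a\<close> over
  the field \<open>'k\<close> of scalars, whose structure map is the ring homomorphism \<open>\<iota>\<close>. The parameter
  \<open>\<lambda>\<close> is called \<open>q\<close>.\<close>

definition multi_indices :: "nat \<Rightarrow> nat \<Rightarrow> nat list set" where
  "multi_indices m n = {js. length js = 2 * m \<and> set js \<subseteq> {1..n}}"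

definition hyperdet ::
  "('k::field_char_0 \<Rightarrow> 'a::comm_ring_1) \<Rightarrow> nat \<Rightarrow> nat \<Rightarrow> (nat list \<Rightarrow> 'a) \<Rightarrow> 'a" where
  "hyperdet \<iota> m n A = \<iota> (1 / fact n) *
     (\<Sum>\<sigma> \<in> {1..2*m} \<rightarrow>\<^sub>E {p. p permutes {1..n}}.
        of_int (\<Prod>k=1..2*m. sign (\<sigma> k)) * (\<Prod>i=1..n. A (map (\<lambda>k. \<sigma> k i) [1..<2*m+1])))"

definition lambda_hyperdet ::
  "('k::field \<Rightarrow> 'a::comm_ring_1) \<Rightarrow> nat \<Rightarrow> nat \<Rightarrow> 'k \<Rightarrow> (nat list \<Rightarrow> 'a) \<Rightarrow> 'a" where
  "lambda_hyperdet \<iota> m n q A = \<iota> ((1 - q) ^ n / qpoch q q n) *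
     (\<Sum>X \<in> {1..2*m} \<rightarrow>\<^sub>E Alt n.
        \<iota> (phi m n q X) * (\<Prod>i=1..n. A (map (\<lambda>k. gen_perm n (X k) i) [1..<2*m+1])))"

text \<open>Limit taken coefficientwise with the entries fixed. A monomial in the entries of \<open>A\<close> is
  given by the finite multiset \<open>\<mu>\<close> of its indices. \<open>F\<close> is, near \<open>q = q0\<close>, a polynomial in the
  entries whose coefficients are rational functions \<open>N \<mu> / D \<mu>\<close> of \<open>q\<close>, and \<open>L\<close> is the polynomial
  whose coefficients \<open>c \<mu>\<close> are the limits of those. No topology on \<open>'a\<close> is involved. \<open>L\<close> does not
  depend on the chosen presentation: the coefficient vectors presenting \<open>0\<close> form a subspace of a
  finite-dimensional space over \<open>'k\<close>, which is closed. If the entries are independent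
  indeterminates the coefficients are uniquely determined; if \<open>'a = 'k\<close> and \<open>\<iota> = id\<close>, the
  ordinary limit results.\<close>

definition coeffwise_limit ::
  "('k::real_normed_field \<Rightarrow> 'a::comm_ring_1) \<Rightarrow> nat list set \<Rightarrow> (nat list \<Rightarrow> 'a) \<Rightarrow> ('k \<Rightarrow> 'a) \<Rightarrow> 'k \<Rightarrow> 'a \<Rightarrow> bool"
  where
  "coeffwise_limit \<iota> I A F q0 L \<longleftrightarrow>
     (\<exists>(S :: nat list multiset set) (N :: nat list multiset \<Rightarrow> 'k poly) D c.
        finite S \<and>
        (\<forall>\<mu>\<in>S. set_mset \<mu> \<subseteq> I \<and> D \<mu> \<noteq> 0 \<and>
           ((\<lambda>q. poly (N \<mu>) q / poly (D \<mu>) q) \<longlongrightarrow> c \<mu>) (at q0)) \<and>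
        (\<forall>\<^sub>F q in at q0.
           F q = (\<Sum>\<mu>\<in>S. \<iota> (poly (N \<mu>) q / poly (D \<mu>) q) * (\<Prod>\<^sub># (image_mset A \<mu>)))) \<and>
        L = (\<Sum>\<mu>\<in>S. \<iota> (c \<mu>) * (\<Prod>\<^sub># (image_mset A \<mu>))))"

end

theory Submission
  imports Defs
begin

text \<open>At \<open>q = 1\<close> every factor of \<open>phi m n q X\<close> stays regular: the powers of \<open>- q ^ k\<close>
tend to \<open>(-1) powi inv_number n x\<close>, while a factor \<open>1 - q powi (- k)\<close> tends to \<open>0\<close> (for
\<open>k = 0\<close> it is \<open>0\<close> throughout). So in the limit a tuple of alternating sign matrices
contributes only if none of its members has an entry \<open>-1\<close>. An alternating sign matrix of that kind is
a permutation matrix; its generalized permutation is the permutation itself and its inversion number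
counts the usual inversions, so that the limiting weight is the sign
(\<open>limit_weight_perm_matrix\<close>). The prefactor is a product of reciprocals of the \<open>q\<close>-integers
\<open>1 + q + \<dots> + q ^ k\<close>, whence its limit \<open>1 / fact n\<close> (\<open>prefactor_regular_at_1\<close>). What remains is
Cayley's sum over tuples of permutations.

Two points go beyond this computation. First, the limit is taken coefficient by coefficient, and
different tuples of matrices may yield the same monomial in the entries. The coefficients are therefore
followed as rational functions whose denominators do not vanish at \<open>1\<close>, a class closed under the
sums that occur when equal monomials are collected (\<open>coeffwise_limitI\<close>). Secondly, the monomials
of all alternating sign matrices, including those whose coefficients vanish in the limit, must involve
genuine entries of the hypermatrix. This is the bound on generalized permutations,
\<open>gen_perm_in_range\<close>, which rests on the alternation of signs.\<close>

section \<open>The sign of a permutation counts its inversions\<close>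

definition index_pairs :: "nat \<Rightarrow> (nat \<times> nat) set" where
  "index_pairs n = {(i, r). 1 \<le> i \<and> i < r \<and> r \<le> n}"

text \<open>Without the signum this would be the Vandermonde product of the values of the permutation; it is
multiplicative for the same reason that the Vandermonde product is alternating.\<close>

definition order_sign :: "nat \<Rightarrow> (nat \<Rightarrow> nat) \<Rightarrow> int" where
  "order_sign n p = (\<Prod>(i, r)\<in>index_pairs n. sgn (int (p r) - int (p i)))"

lemma finite_index_pairs [simp]: "finite (index_pairs n)"
  by (rule finite_subset[of _ "{1..n} \<times> {1..n}"]) (auto simp: index_pairs_def)

text \<open>A symmetric function lives on unordered pairs, and a permutation of the indices permutes those.\<close>

lemma prod_index_pairs_permute:
  fixes g :: "nat \<Rightarrow> nat \<Rightarrow> int"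
  assumes p: "p permutes {1..n}" and sym: "\<And>a b. g a b = g b a"
  shows "(\<Prod>(i, r)\<in>index_pairs n. g (p i) (p r)) = (\<Prod>(i, r)\<in>index_pairs n. g i r)"
proof -
  \<comment> \<open>An unordered pair is represented by its increasing arrangement, so the reindexing map
    applies the permutation and then sorts.\<close>
  define sort2 :: "nat \<times> nat \<Rightarrow> nat \<times> nat" where "sort2 = (\<lambda>(a, b). (min a b, max a b))"
  have sort_mem: "sort2 (f i, f r) \<in> index_pairs n"
    if "f permutes {1..n}" "(i, r) \<in> index_pairs n" for f i r
  proof -
    have "f i \<in> {1..n}" "f r \<in> {1..n}" "f i \<noteq> f r"
      using that permutes_in_image[OF that(1)] permutes_inj[OF that(1)]
      by (auto simp: index_pairs_def dest: injD)
    thus ?thesis by (auto simp: sort2_def index_pairs_def min_def max_def)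
  qed
  have sort_inv: "sort2 (map_prod f f (sort2 (h i, h r))) = (i, r)"
    if "\<And>x. f (h x) = x" "(i, r) \<in> index_pairs n" for f h i r
    using that by (auto simp: sort2_def index_pairs_def min_def max_def)
  show ?thesis
  proof (rule prod.reindex_bij_witness[where
        i = "\<lambda>x. sort2 (map_prod (inv p) (inv p) x)" and j = "\<lambda>x. sort2 (map_prod p p x)"])
    fix x assume x: "x \<in> index_pairs n"
    obtain i r where ir: "x = (i, r)" by force
    show "sort2 (map_prod (inv p) (inv p) (sort2 (map_prod p p x))) = x"
      using sort_inv[of "inv p" p i r] x ir permutes_inverses[OF p] by simp
    show "sort2 (map_prod p p (sort2 (map_prod (inv p) (inv p) x))) = x"
      using sort_inv[of p "inv p" i r] x ir permutes_inverses[OF p] by simp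
    show "sort2 (map_prod p p x) \<in> index_pairs n"
      using sort_mem[OF p] x ir by simp
    show "sort2 (map_prod (inv p) (inv p) x) \<in> index_pairs n"
      using sort_mem[OF permutes_inv[OF p]] x ir by simp
    show "(case sort2 (map_prod p p x) of (i, r) \<Rightarrow> g i r) = (case x of (i, r) \<Rightarrow> g (p i) (p r))"
      using sym[of "p i" "p r"] by (auto simp: ir sort2_def min_def max_def)
  qed
qed

lemma order_sign_compose:
  assumes p: "p permutes {1..n}" and q: "q permutes {1..n}"
  shows "order_sign n (p \<circ> q) = order_sign n p * order_sign n q"
proof -
  \<comment> \<open>Splitting off the sign for the inner permutation leaves a factor that is symmetric in its two
    arguments, being a product of two antisymmetric ones.\<close>
  define g where "g = (\<lambda>a b. sgn (int (p b) - int (p a)) * sgn (int b - int a))"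
  have sym: "g a b = g b a" for a b
    by (auto simp: g_def sgn_if)
  have "order_sign n (p \<circ> q)
      = (\<Prod>(i, r)\<in>index_pairs n. g (q i) (q r) * sgn (int (q r) - int (q i)))"
    unfolding order_sign_def
  proof (rule prod.cong[OF refl], clarsimp)
    fix i r assume "(i, r) \<in> index_pairs n"
    hence "q i \<noteq> q r" using permutes_inj[OF q] by (auto simp: index_pairs_def dest: injD)
    thus "sgn (int (p (q r)) - int (p (q i))) = g (q i) (q r) * sgn (int (q r) - int (q i))"
      by (auto simp: g_def sgn_if)
  qed
  also have "\<dots> = (\<Prod>(i, r)\<in>index_pairs n. g (q i) (q r)) * order_sign n q"
    by (simp add: order_sign_def prod.distrib split_def)
  also have "(\<Prod>(i, r)\<in>index_pairs n. g (q i) (q r)) = (\<Prod>(i, r)\<in>index_pairs n. g i r)"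
    by (rule prod_index_pairs_permute[OF q sym])
  also have "\<dots> = order_sign n p"
    unfolding order_sign_def by (rule prod.cong) (auto simp: g_def index_pairs_def)
  finally show ?thesis .
qed

lemma order_sign_eq_card:
  assumes "p permutes {1..n}"
  shows "order_sign n p = (-1) ^ card {(i, r)\<in>index_pairs n. p r < p i}"
proof -
  have "order_sign n p = (\<Prod>x\<in>index_pairs n. if p (snd x) < p (fst x) then -1 else 1)"
    unfolding order_sign_def
  proof (rule prod.cong[OF refl])
    fix x assume x: "x \<in> index_pairs n"
    obtain i r where ir: "x = (i, r)" by force
    have "i \<noteq> r" using x by (simp add: ir index_pairs_def)
    hence "p i \<noteq> p r" using permutes_inj[OF assms] by (meson injD)
    thus "(case x of (i, r) \<Rightarrow> sgn (int (p r) - int (p i))) = (if p (snd x) < p (fst x) then -1 else 1)"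
      by (simp add: ir sgn_if)
  qed
  also have "\<dots> = (\<Prod>x\<in>{x\<in>index_pairs n. p (snd x) < p (fst x)}. -1)"
    by (simp only: prod.inter_filter[OF finite_index_pairs])
  also have "{x\<in>index_pairs n. p (snd x) < p (fst x)} = {(i, r)\<in>index_pairs n. p r < p i}"
    by auto
  finally show ?thesis by simp
qed

text \<open>The inversions of a transposition of \<open>a < b\<close> are the pair \<open>(a, b)\<close> and, for each \<open>c\<close>
strictly between, the two pairs \<open>(a, c)\<close> and \<open>(c, b)\<close>: an odd number.\<close>

lemma order_sign_transpose:
  assumes "a \<in> {1..n}" "b \<in> {1..n}" "a < b"
  shows "order_sign n (Transposition.transpose a b) = -1"
proof -
  let ?t = "Transposition.transpose a b"
  let ?C = "(\<lambda>c. (a, c)) ` {a<..<b} \<union> (\<lambda>c. (c, b)) ` {a<..<b}"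
  have inv: "(1 \<le> i \<and> i < r \<and> r \<le> n \<and> ?t r < ?t i)
      \<longleftrightarrow> i = a \<and> r = b \<or> i = a \<and> a < r \<and> r < b \<or> r = b \<and> a < i \<and> i < b" for i r
    using assms by (auto simp: Transposition.transpose_def)
  have mem: "(i, r) \<in> insert (a, b) ?C
      \<longleftrightarrow> i = a \<and> r = b \<or> i = a \<and> a < r \<and> r < b \<or> r = b \<and> a < i \<and> i < b" for i r
    by auto
  have inversions: "{(i, r)\<in>index_pairs n. ?t r < ?t i} = insert (a, b) ?C"
  proof (rule set_eqI)
    fix x :: "nat \<times> nat"
    obtain i r where x: "x = (i, r)" by force
    have "x \<in> {(i, r)\<in>index_pairs n. ?t r < ?t i}
        \<longleftrightarrow> 1 \<le> i \<and> i < r \<and> r \<le> n \<and> ?t r < ?t i"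
      by (simp add: x index_pairs_def)
    thus "x \<in> {(i, r)\<in>index_pairs n. ?t r < ?t i} \<longleftrightarrow> x \<in> insert (a, b) ?C"
      unfolding x inv mem .
  qed
  have card: "card ?C = 2 * card {a<..<b}"
    by (subst card_Un_disjoint) (auto simp: card_image inj_on_def)
  have "finite ?C" "(a, b) \<notin> ?C" by auto
  from card_insert_disjoint[OF this]
  have "card {(i, r)\<in>index_pairs n. ?t r < ?t i} = Suc (2 * card {a<..<b})"
    unfolding inversions card .
  with order_sign_eq_card[OF permutes_swap_id[OF assms(1,2)]]
  have "order_sign n ?t = (-1) ^ Suc (2 * card {a<..<b})"
    by (simp only:)
  thus ?thesis by (simp only: power_Suc power_mult power2_minus one_power2 power_one mult_1_right)
qed

text \<open>Both sides are multiplicative and agree on transpositions, which generate the symmetric group.\<close>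

lemma sign_eq_order_sign:
  assumes "p permutes {1..n}"
  shows "sign p = order_sign n p"
  using assms finite_atLeastAtMost
proof (induction rule: permutes_induct)
  case id
  have "order_sign n id = 1" unfolding order_sign_def
    by (rule prod.neutral) (auto simp: index_pairs_def)
  thus ?case by (simp only: sign_id)
next
  case (swap a b p)
  let ?t = "Transposition.transpose a b"
  have t: "?t permutes {1..n}" using swap(1,2) by (rule permutes_swap_id)
  have "permutation ?t" "permutation p"
    by (intro iffD2[OF permutation_permutes] exI[of _ "{1..n}"] conjI finite_atLeastAtMost t swap(4))+
  hence sgn: "sign (?t \<circ> p) = sign ?t * sign p" by (rule sign_compose)
  have "order_sign n ?t = sign ?t"
  proof (cases "a < b")
    case True
    hence "order_sign n ?t = -1" using swap(1,2) by (intro order_sign_transpose)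
    thus ?thesis using swap(3) by (simp only: sign_swap_id if_False)
  next
    case False
    hence "b < a" using swap(3) by simp
    hence "order_sign n (Transposition.transpose b a) = -1"
      using swap(1,2) by (intro order_sign_transpose)
    thus ?thesis using swap(3) by (simp only: transpose_commute[of a b] sign_swap_id) simp
  qed
  thus ?case unfolding sgn order_sign_compose[OF t swap(4)] swap(5) by (simp only:)
qed

lemma sign_eq_minus_one_power_inversions:
  assumes "p permutes {1..n}"
  shows "sign p = (-1) ^ card {(i, r)\<in>index_pairs n. p r < p i}"
  using sign_eq_order_sign[OF assms] order_sign_eq_card[OF assms] by (rule trans)

section \<open>Alternating sign matrices without negative entries\<close>

definition perm_matrix :: "nat \<Rightarrow> (nat \<Rightarrow> nat) \<Rightarrow> nat \<Rightarrow> nat \<Rightarrow> int" where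
  "perm_matrix n p i j = (if i \<in> {1..n} \<and> j = p i then 1 else 0)"

lemma perm_matrix_in_Alt:
  assumes p: "p permutes {1..n}"
  shows "perm_matrix n p \<in> Alt n"
proof -
  have inj: "p a = p b \<longleftrightarrow> a = b" for a b using permutes_inj[OF p] by (auto dest: injD)
  have mem: "p i \<in> {1..n} \<longleftrightarrow> i \<in> {1..n}" for i using permutes_in_image[OF p] .
  have row: "(\<Sum>j=1..n. perm_matrix n p i j) = 1" if "i \<in> {1..n}" for i
    using that mem[of i] by (simp add: perm_matrix_def sum.delta)
  have col: "(\<Sum>i=1..n. perm_matrix n p i j) = 1" if j: "j \<in> {1..n}" for j
  proof -
    have "(\<Sum>i=1..n. perm_matrix n p i j) = (\<Sum>i=1..n. if i = inv p j then 1 else 0)"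
      by (rule sum.cong) (auto simp: perm_matrix_def permutes_inverses[OF p])
    moreover have "inv p j \<in> {1..n}" using permutes_in_image[OF permutes_inv[OF p]] j by simp
    ultimately show ?thesis by simp
  qed
  have zero: "perm_matrix n p i j = 0" if "\<not> (i \<in> {1..n} \<and> j \<in> {1..n})" for i j
    using that mem[of i] by (auto simp: perm_matrix_def)
  have ent: "perm_matrix n p i j \<in> {0, 1, -1}" for i j
    by (auto simp: perm_matrix_def)
  have "alternating_on n (\<lambda>j. perm_matrix n p i j)" "alternating_on n (\<lambda>k. perm_matrix n p k i)" for i
    unfolding alternating_on_def perm_matrix_def
    by (auto split: if_splits simp: inj)
  with row col zero ent show ?thesis unfolding Alt_def by blast
qed

lemma neg_count_eq_0_iff:
  "neg_count n x = 0 \<longleftrightarrow> (\<forall>i\<in>{1..n}. \<forall>j\<in>{1..n}. x i j \<noteq> -1)"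
proof -
  have "finite {(i, j). i \<in> {1..n} \<and> j \<in> {1..n} \<and> x i j = -1}"
    by (rule finite_subset[of _ "{1..n} \<times> {1..n}"]) auto
  thus ?thesis unfolding neg_count_def by (subst card_0_eq) auto
qed

lemma neg_count_perm_matrix [simp]: "neg_count n (perm_matrix n p) = 0"
  by (auto simp: neg_count_eq_0_iff perm_matrix_def)

lemma gen_perm_perm_matrix:
  assumes "p permutes {1..n}" "i \<in> {1..n}"
  shows "gen_perm n (perm_matrix n p) i = p i"
proof -
  have "p i \<in> {1..n}" using assms permutes_in_image[of p "{1..n}" i] by simp
  moreover have "(\<Sum>j=1..n. int j * perm_matrix n p i j) = (\<Sum>j=1..n. if j = p i then int j else 0)"
    using assms(2) by (intro sum.cong) (auto simp: perm_matrix_def)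
  ultimately show ?thesis by (simp add: gen_perm_def)
qed

text \<open>A nonzero product of two entries requires \<open>j = p i\<close> and \<open>s = p r\<close>, so the inner double sum
over columns is the indicator of an inversion at the rows \<open>i < r\<close>.\<close>

lemma inv_number_perm_matrix:
  assumes p: "p permutes {1..n}"
  shows "inv_number n (perm_matrix n p) = int (card {(i, r)\<in>index_pairs n. p r < p i})"
proof -
  have mem: "p i \<in> {1..n}" if "i \<in> {1..n}" for i using permutes_in_image[OF p] that by blast
  have "inv_number n (perm_matrix n p)
      = (\<Sum>i=1..n. \<Sum>r\<in>{i<..n}. \<Sum>j=1..n. \<Sum>s\<in>{1..<j}. perm_matrix n p i j * perm_matrix n p r s)"
    unfolding inv_number_def by (intro sum.cong refl sum.swap)
  also have "\<dots> = (\<Sum>i=1..n. \<Sum>r\<in>{i<..n}. if p r < p i then 1 else 0)"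
  proof (intro sum.cong refl)
    fix i r assume i: "i \<in> {1..n}" and r: "r \<in> {i<..n}"
    hence r': "r \<in> {1..n}" by auto
    have "(\<Sum>j=1..n. \<Sum>s\<in>{1..<j}. perm_matrix n p i j * perm_matrix n p r s)
        = (\<Sum>j=1..n. if j = p i then (\<Sum>s\<in>{1..<j}. if s = p r then 1 else 0) else 0)"
      using i r' by (intro sum.cong refl) (auto simp: perm_matrix_def intro!: sum.cong)
    also have "\<dots> = (\<Sum>s\<in>{1..<p i}. if s = p r then 1 else 0)"
      using mem[OF i] by simp
    also have "\<dots> = (if p r < p i then 1 else 0)"
      using mem[OF r'] by auto
    finally show "(\<Sum>j=1..n. \<Sum>s\<in>{1..<j}. perm_matrix n p i j * perm_matrix n p r s)
        = (if p r < p i then 1 else 0)" .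
  qed
  also have "\<dots> = (\<Sum>x\<in>(SIGMA i:{1..n}. {i<..n}). if p (snd x) < p (fst x) then 1 else 0)"
    by (subst sum.Sigma) (auto simp: split_def)
  also have "(SIGMA i:{1..n}. {i<..n}) = index_pairs n"
    by (auto simp: index_pairs_def)
  also have "(\<Sum>x\<in>index_pairs n. if p (snd x) < p (fst x) then 1 else 0)
      = int (card {x\<in>index_pairs n. p (snd x) < p (fst x)})"
    by (simp add: sum.inter_filter[symmetric])
  also have "{x\<in>index_pairs n. p (snd x) < p (fst x)} = {(i, r)\<in>index_pairs n. p r < p i}"
    by auto
  finally show ?thesis .
qed

lemma sum_01_eq_1_unique:
  fixes f :: "'b \<Rightarrow> int"
  assumes "finite S" "\<forall>j\<in>S. f j \<in> {0, 1}" "sum f S = 1"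
  shows "\<exists>k\<in>S. \<forall>j\<in>S. f j = (if j = k then 1 else 0)"
proof -
  have "sum f S = (\<Sum>j\<in>S. if f j = 1 then 1 else 0)"
    using assms(2) by (intro sum.cong) auto
  also have "\<dots> = int (card {j\<in>S. f j = 1})"
    using assms(1) by (simp add: sum.inter_filter[symmetric])
  finally have "card {j\<in>S. f j = 1} = 1" using assms(3) by simp
  then obtain k where k: "{j\<in>S. f j = 1} = {k}" by (auto simp: card_1_singleton_iff)
  have "f j = (if j = k then 1 else 0)" if "j \<in> S" for j
    using k assms(2) that by (cases "f j = 1") auto
  moreover have "k \<in> S" using k by blast
  ultimately show ?thesis by blast
qed

text \<open>With entries in \<open>{0, 1}\<close>, line sums equal to \<open>1\<close> leave a single \<open>1\<close> in each row and in each
column. The rows define a map on the indices and the columns make it injective.\<close>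

lemma nonneg_Alt_is_perm_matrix:
  assumes x: "x \<in> Alt n" and nonneg: "neg_count n x = 0"
  obtains p where "p permutes {1..n}" "x = perm_matrix n p"
proof -
  have ent: "x i j \<in> {0, 1}" if "i \<in> {1..n}" "j \<in> {1..n}" for i j
    using x nonneg that unfolding Alt_def neg_count_eq_0_iff by blast
  have zero: "x i j = 0" if "\<not> (i \<in> {1..n} \<and> j \<in> {1..n})" for i j
    using x that unfolding Alt_def by blast
  have "\<exists>k\<in>{1..n}. \<forall>j\<in>{1..n}. x i j = (if j = k then 1 else 0)" if i: "i \<in> {1..n}" for i
  proof (rule sum_01_eq_1_unique)
    show "\<forall>j\<in>{1..n}. x i j \<in> {0, 1}" using ent[OF i] by blast
    show "(\<Sum>j=1..n. x i j) = 1" using x i unfolding Alt_def by blast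
  qed simp
  hence "\<forall>i\<in>{1..n}. \<exists>k. k \<in> {1..n} \<and> (\<forall>j\<in>{1..n}. x i j = (if j = k then 1 else 0))"
    by blast
  from bchoice[OF this] obtain f where f: "\<And>i. i \<in> {1..n} \<Longrightarrow> f i \<in> {1..n}"
      "\<And>i j. i \<in> {1..n} \<Longrightarrow> j \<in> {1..n} \<Longrightarrow> x i j = (if j = f i then 1 else 0)"
    by blast
  have "inj_on f {1..n}"
  proof (rule inj_onI)
    fix a b assume ab: "a \<in> {1..n}" "b \<in> {1..n}" "f a = f b"
    have "\<exists>k\<in>{1..n}. \<forall>i\<in>{1..n}. x i (f a) = (if i = k then 1 else 0)"
    proof (rule sum_01_eq_1_unique)
      show "\<forall>i\<in>{1..n}. x i (f a) \<in> {0, 1}" using ent f(1)[OF ab(1)] by blast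
      show "(\<Sum>i=1..n. x i (f a)) = 1" using x f(1)[OF ab(1)] unfolding Alt_def by blast
    qed simp
    then obtain k where k: "\<And>i. i \<in> {1..n} \<Longrightarrow> x i (f a) = (if i = k then 1 else 0)"
      by blast
    have "x a (f a) = 1" using f(2)[OF ab(1) f(1)[OF ab(1)]] by simp
    hence "a = k" using k[OF ab(1)] by (simp split: if_splits)
    have "x b (f a) = 1" using f(2)[OF ab(2) f(1)[OF ab(1)]] ab(3) by simp
    hence "b = k" using k[OF ab(2)] by (simp split: if_splits)
    with \<open>a = k\<close> show "a = b" by simp
  qed
  moreover have "f ` {1..n} \<subseteq> {1..n}" using f(1) by blast
  ultimately have bij: "bij_betw f {1..n} {1..n}"
    by (simp add: bij_betw_def endo_inj_surj)
  define p where "p = (\<lambda>i. if i \<in> {1..n} then f i else i)"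
  have "bij_betw p {1..n} {1..n}"
    using bij by (rule bij_betw_cong[THEN iffD1, rotated]) (auto simp: p_def)
  hence "p permutes {1..n}" by (rule bij_imp_permutes) (auto simp: p_def)
  moreover have "x = perm_matrix n p"
  proof (intro ext)
    fix i j
    show "x i j = perm_matrix n p i j"
    proof (cases "i \<in> {1..n} \<and> j \<in> {1..n}")
      case True
      thus ?thesis using f(2)[of i j] by (simp add: perm_matrix_def p_def)
    next
      case False
      hence "\<not> (i \<in> {1..n} \<and> j = p i)" using f(1)[of i] by (auto simp: p_def)
      thus ?thesis using zero[OF False] unfolding perm_matrix_def by presburger
    qed
  qed
  ultimately show ?thesis using that by blast
qed

lemma perm_matrix_inj:
  assumes "p permutes {1..n}" "q permutes {1..n}" "perm_matrix n p = perm_matrix n q"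
  shows "p = q"
proof
  fix i show "p i = q i"
    using gen_perm_perm_matrix[OF assms(1), of i] gen_perm_perm_matrix[OF assms(2), of i] assms
    by (cases "i \<in> {1..n}") (auto simp: permutes_not_in)
qed

lemma bij_betw_perm_matrix:
  "bij_betw (perm_matrix n) {p. p permutes {1..n}} {x\<in>Alt n. neg_count n x = 0}"
proof (rule bij_betw_imageI)
  show "inj_on (perm_matrix n) {p. p permutes {1..n}}"
    by (rule inj_onI) (simp add: perm_matrix_inj)
  show "perm_matrix n ` {p. p permutes {1..n}} = {x\<in>Alt n. neg_count n x = 0}"
  proof (intro equalityI subsetI)
    fix x assume "x \<in> {x\<in>Alt n. neg_count n x = 0}"
    then obtain p where "p permutes {1..n}" "x = perm_matrix n p"
      using nonneg_Alt_is_perm_matrix[of x n] by blast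
    thus "x \<in> perm_matrix n ` {p. p permutes {1..n}}" by blast
  qed (auto simp: perm_matrix_in_Alt)
qed

lemma finite_Alt: "finite (Alt n)"
proof -
  let ?F = "{f. \<forall>z. (z \<in> {1..n} \<times> {1..n} \<longrightarrow> f z \<in> {0, 1, -1::int}) \<and>
    (z \<notin> {1..n} \<times> {1..n} \<longrightarrow> f z = 0)}"
  have "finite ?F" by (rule finite_set_of_finite_funs) auto
  moreover have "x \<in> curry ` ?F" if "x \<in> Alt n" for x
  proof (rule image_eqI)
    show "x = curry (case_prod x)" by simp
    have "x i j \<in> {0, 1, -1}" if "i \<in> {1..n}" "j \<in> {1..n}" for i j
      using \<open>x \<in> Alt n\<close> that unfolding Alt_def by blast
    moreover have "x i j = 0" if "\<not> (i \<in> {1..n} \<and> j \<in> {1..n})" for i j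
      using \<open>x \<in> Alt n\<close> that unfolding Alt_def by blast
    ultimately show "case_prod x \<in> ?F" by (simp add: split_def mem_Times_iff)
  qed
  ultimately show ?thesis by (meson finite_imageI finite_subset subsetI)
qed

section \<open>The generalized permutation stays within range\<close>

text \<open>Between two consecutive entries \<open>1\<close> there is an entry \<open>-1\<close>, so partial sums never reach
\<open>2\<close>. Allowing any starting point covers initial and final segments at once.\<close>

lemma alternating_interval_sum_le_1:
  assumes alt: "alternating_on n v" and ent: "\<And>j. j \<in> {1..n} \<Longrightarrow> v j \<in> {0, 1, -1}"
    and a: "1 \<le> a" and b: "b \<le> n"
  shows "(\<Sum>j=a..b. v j) \<le> 1"
proof -
  define S where "S b = (\<Sum>j=a..b. v j)" for b
  \<comment> \<open>To be able to append an entry \<open>1\<close>, the induction also needs the sharper bound \<open>0\<close> for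
    intervals whose last nonzero entry is \<open>-1\<close>.\<close>
  define ends_neg where
    "ends_neg b \<longleftrightarrow> (\<exists>l\<in>{a..b}. v l = -1 \<and> (\<forall>k\<in>{l<..b}. v k = 0))" for b
  have "b \<le> n \<Longrightarrow> S b \<le> 1 \<and> (ends_neg b \<longrightarrow> S b \<le> 0)"
  proof (induction b)
    case 0
    thus ?case using a by (simp add: S_def ends_neg_def)
  next
    case (Suc b)
    have IH: "S b \<le> 1" "ends_neg b \<Longrightarrow> S b \<le> 0" using Suc by simp_all
    show ?case
    proof (cases "a \<le> Suc b")
      case False
      thus ?thesis by (simp add: S_def ends_neg_def)
    next
      case True
      hence sum: "S (Suc b) = S b + v (Suc b)" by (simp add: S_def)
      have "v (Suc b) \<in> {0, 1, -1}" using ent[of "Suc b"] Suc.prems by simp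
      then consider "v (Suc b) = 0" | "v (Suc b) = 1" | "v (Suc b) = -1" by blast
      thus ?thesis
      proof cases
        case 1
        have "ends_neg b" if neg: "ends_neg (Suc b)"
        proof -
          obtain l where l: "l \<in> {a..Suc b}" "v l = -1" "\<forall>k\<in>{l<..Suc b}. v k = 0"
            using neg unfolding ends_neg_def by blast
          hence "l \<noteq> Suc b" using 1 by force
          hence "l \<in> {a..b}" using l(1) by simp
          thus ?thesis using l(2,3) unfolding ends_neg_def by force
        qed
        thus ?thesis using IH 1 sum by simp
      next
        case 2
        have "S b \<le> 0"
        proof (cases "\<forall>j\<in>{a..b}. v j = 0")
          case True
          thus ?thesis by (simp add: S_def)
        next
          case False
          define l where "l = Max {j\<in>{a..b}. v j \<noteq> 0}"
          have "l \<in> {j\<in>{a..b}. v j \<noteq> 0}"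
            unfolding l_def using False by (intro Max_in) auto
          hence l: "l \<in> {a..b}" "v l \<noteq> 0" by simp_all
          have gap: "v k = 0" if "k \<in> {l<..b}" for k
          proof (rule ccontr)
            assume "v k \<noteq> 0"
            hence "k \<le> l" unfolding l_def using that l(1) by (intro Max_ge) simp_all
            thus False using that by simp
          qed
          have "l \<in> {1..n}" "Suc b \<in> {1..n}" "l < Suc b" "\<forall>k\<in>{l<..<Suc b}. v k = 0"
            using l(1) a Suc.prems gap by simp_all
          hence "v (Suc b) = - v l"
            using alt l(2) 2 unfolding alternating_on_def by (metis zero_neq_one)
          hence "v l = -1" using 2 by simp
          hence "ends_neg b" using l(1) gap unfolding ends_neg_def by blast
          thus ?thesis by (rule IH(2))
        qed
        moreover have "\<not> ends_neg (Suc b)"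
        proof
          assume "ends_neg (Suc b)"
          then obtain l where l: "l \<in> {a..Suc b}" "v l = -1" "\<forall>k\<in>{l<..Suc b}. v k = 0"
            unfolding ends_neg_def by blast
          show False
          proof (cases "l = Suc b")
            case True
            thus False using l(2) 2 by simp
          next
            case False
            hence "Suc b \<in> {l<..Suc b}" using l(1) by simp
            thus False using l(3) 2 by force
          qed
        qed
        ultimately show ?thesis using 2 sum by simp
      next
        case 3
        thus ?thesis using sum IH(1) by simp
      qed
    qed
  qed
  thus ?thesis using b by (simp add: S_def)
qed

text \<open>Summation by parts writes \<open>\<Sum>j. j * x i j\<close> as the sum of the \<open>n\<close> tail sums
\<open>T k = (\<Sum>j\<ge>k. x i j)\<close>. Each tail sum is at most \<open>1\<close>, and at least \<open>0\<close> because the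
complementary initial segment has sum at most \<open>1\<close>; the first one is the full row sum \<open>1\<close>.\<close>

lemma gen_perm_in_range:
  assumes x: "x \<in> Alt n" and i: "i \<in> {1..n}"
  shows "gen_perm n x i \<in> {1..n}"
proof -
  have alt: "alternating_on n (x i)" and row: "(\<Sum>j=1..n. x i j) = 1"
    and ent: "\<And>j. j \<in> {1..n} \<Longrightarrow> x i j \<in> {0, 1, -1}"
    using x i unfolding Alt_def by blast+
  define T where "T k = (\<Sum>j=k..n. x i j)" for k
  have T: "0 \<le> T k \<and> T k \<le> 1" if k: "k \<in> {1..n}" for k
  proof -
    have "{1..n} = {1..k-1} \<union> {k..n}" "{1..k-1} \<inter> {k..n} = {}" using k by auto
    hence "(\<Sum>j=1..n. x i j) = (\<Sum>j=1..k-1. x i j) + T k"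
      unfolding T_def by (simp add: sum.union_disjoint)
    moreover have "(\<Sum>j=1..k-1. x i j) \<le> 1"
      using k by (intro alternating_interval_sum_le_1[OF alt ent]) auto
    moreover have "T k \<le> 1"
      unfolding T_def using k by (intro alternating_interval_sum_le_1[OF alt ent]) auto
    ultimately show ?thesis using row by simp
  qed
  have "(\<Sum>j=1..n. int j * x i j) = (\<Sum>j=1..n. \<Sum>k=1..j. x i j)" by simp
  also have "\<dots> = (\<Sum>j=1..n. \<Sum>k | k \<in> {1..n} \<and> k \<le> j. x i j)"
    by (intro sum.cong refl) auto
  also have "\<dots> = (\<Sum>k=1..n. \<Sum>j | j \<in> {1..n} \<and> k \<le> j. x i j)"
    by (rule sum.swap_restrict) auto
  also have "\<dots> = (\<Sum>k=1..n. T k)"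
    unfolding T_def by (intro sum.cong refl) auto
  finally have eq: "(\<Sum>j=1..n. int j * x i j) = (\<Sum>k=1..n. T k)" .
  have "(\<Sum>k=1..n. T k) \<le> (\<Sum>k=1..n. 1)" using T by (intro sum_mono) auto
  moreover have "T 1 \<le> (\<Sum>k=1..n. T k)" using T i by (intro member_le_sum) auto
  moreover have "T 1 = 1" unfolding T_def by (rule row)
  ultimately show ?thesis using eq by (auto simp: gen_perm_def le_nat_iff nat_le_iff)
qed

section \<open>Rational functions regular at a point\<close>

text \<open>Values of \<open>f\<close> at \<open>a\<close> itself are left open, since expressions such as the prefactor have a
removable singularity there. As the denominator does not vanish at \<open>a\<close>, convergence to \<open>c\<close> is
automatic, and the algebraic closure properties need no argument about limits.\<close>

definition rational_regular_at :: "('k::real_normed_field \<Rightarrow> 'k) \<Rightarrow> 'k \<Rightarrow> 'k \<Rightarrow> bool" where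
  "rational_regular_at f a c \<longleftrightarrow> (\<exists>N D. poly D a \<noteq> 0 \<and> c = poly N a / poly D a \<and>
     (\<forall>\<^sub>F q in at a. f q = poly N q / poly D q))"

lemma eventually_poly_nonzero:
  fixes D :: "'k::real_normed_field poly"
  assumes "poly D a \<noteq> 0"
  shows "\<forall>\<^sub>F q in at a. poly D q \<noteq> 0"
  using assms by (intro tendsto_imp_eventually_ne[of _ "poly D a"] tendsto_poly tendsto_ident_at)

lemma rational_regular_at_const: "rational_regular_at (\<lambda>_. c) a c"
  unfolding rational_regular_at_def by (intro exI[of _ "[:c:]"] exI[of _ 1]) simp

lemma rational_regular_at_ident: "rational_regular_at (\<lambda>q. q) a a"
  unfolding rational_regular_at_def by (intro exI[of _ "[:0, 1:]"] exI[of _ 1]) simp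

lemma rational_regular_at_add:
  assumes "rational_regular_at f a c" "rational_regular_at g a d"
  shows "rational_regular_at (\<lambda>q. f q + g q) a (c + d)"
proof -
  obtain N D where 1: "poly D a \<noteq> 0" "c = poly N a / poly D a"
    "\<forall>\<^sub>F q in at a. f q = poly N q / poly D q"
    using assms(1) unfolding rational_regular_at_def by blast
  obtain N' D' where 2: "poly D' a \<noteq> 0" "d = poly N' a / poly D' a"
    "\<forall>\<^sub>F q in at a. g q = poly N' q / poly D' q"
    using assms(2) unfolding rational_regular_at_def by blast
  have "\<forall>\<^sub>F q in at a. f q + g q = poly (N * D' + N' * D) q / poly (D * D') q"
    using 1(3) 2(3) eventually_poly_nonzero[OF 1(1)] eventually_poly_nonzero[OF 2(1)]
    by eventually_elim (simp add: add_frac_eq mult.commute)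
  thus ?thesis unfolding rational_regular_at_def using 1 2
    by (intro exI[of _ "N * D' + N' * D"] exI[of _ "D * D'"]) (simp add: add_frac_eq mult.commute)
qed

lemma rational_regular_at_mult:
  assumes "rational_regular_at f a c" "rational_regular_at g a d"
  shows "rational_regular_at (\<lambda>q. f q * g q) a (c * d)"
proof -
  obtain N D where 1: "poly D a \<noteq> 0" "c = poly N a / poly D a"
    "\<forall>\<^sub>F q in at a. f q = poly N q / poly D q"
    using assms(1) unfolding rational_regular_at_def by blast
  obtain N' D' where 2: "poly D' a \<noteq> 0" "d = poly N' a / poly D' a"
    "\<forall>\<^sub>F q in at a. g q = poly N' q / poly D' q"
    using assms(2) unfolding rational_regular_at_def by blast
  have "\<forall>\<^sub>F q in at a. f q * g q = poly (N * N') q / poly (D * D') q"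
    using 1(3) 2(3) by eventually_elim simp
  thus ?thesis unfolding rational_regular_at_def using 1 2
    by (intro exI[of _ "N * N'"] exI[of _ "D * D'"]) simp
qed

lemma rational_regular_at_inverse:
  assumes "rational_regular_at f a c" "c \<noteq> 0"
  shows "rational_regular_at (\<lambda>q. inverse (f q)) a (inverse c)"
proof -
  obtain N D where 1: "poly D a \<noteq> 0" "c = poly N a / poly D a"
    "\<forall>\<^sub>F q in at a. f q = poly N q / poly D q"
    using assms(1) unfolding rational_regular_at_def by blast
  have "\<forall>\<^sub>F q in at a. inverse (f q) = poly D q / poly N q"
    using 1(3) by eventually_elim simp
  thus ?thesis unfolding rational_regular_at_def using 1 assms(2)
    by (intro exI[of _ D] exI[of _ N]) auto
qed

lemma rational_regular_at_cong:
  assumes "rational_regular_at f a c" "\<forall>\<^sub>F q in at a. g q = f q"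
  shows "rational_regular_at g a c"
proof -
  obtain N D where 1: "poly D a \<noteq> 0" "c = poly N a / poly D a"
    "\<forall>\<^sub>F q in at a. f q = poly N q / poly D q"
    using assms(1) unfolding rational_regular_at_def by blast
  have "\<forall>\<^sub>F q in at a. g q = poly N q / poly D q"
    using 1(3) assms(2) by eventually_elim simp
  with 1 show ?thesis unfolding rational_regular_at_def by blast
qed

lemma rational_regular_at_uminus:
  "rational_regular_at f a c \<Longrightarrow> rational_regular_at (\<lambda>q. - f q) a (- c)"
  using rational_regular_at_mult[OF rational_regular_at_const[of "-1"]] by fastforce

lemma rational_regular_at_diff:
  "rational_regular_at f a c \<Longrightarrow> rational_regular_at g a d \<Longrightarrow>
   rational_regular_at (\<lambda>q. f q - g q) a (c - d)"
  using rational_regular_at_add[OF _ rational_regular_at_uminus, of f a c g d] by simp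

lemma rational_regular_at_power:
  "rational_regular_at f a c \<Longrightarrow> rational_regular_at (\<lambda>q. f q ^ k) a (c ^ k)"
  by (induction k) (simp_all add: rational_regular_at_const rational_regular_at_mult)

lemma rational_regular_at_powi:
  "rational_regular_at f a c \<Longrightarrow> c \<noteq> 0 \<Longrightarrow> rational_regular_at (\<lambda>q. f q powi z) a (c powi z)"
  by (simp add: power_int_def rational_regular_at_power rational_regular_at_inverse)

lemma rational_regular_at_sum:
  "(\<And>i. i \<in> S \<Longrightarrow> rational_regular_at (f i) a (c i)) \<Longrightarrow>
   rational_regular_at (\<lambda>q. \<Sum>i\<in>S. f i q) a (\<Sum>i\<in>S. c i)"
  by (induction S rule: infinite_finite_induct)
    (simp_all add: rational_regular_at_const rational_regular_at_add)

lemma rational_regular_at_prod: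
  "(\<And>i. i \<in> S \<Longrightarrow> rational_regular_at (f i) a (c i)) \<Longrightarrow>
   rational_regular_at (\<lambda>q. \<Prod>i\<in>S. f i q) a (\<Prod>i\<in>S. c i)"
  by (induction S rule: infinite_finite_induct)
    (simp_all add: rational_regular_at_const rational_regular_at_mult)

lemmas rational_regular_at_intros =
  rational_regular_at_const rational_regular_at_ident rational_regular_at_uminus
  rational_regular_at_diff rational_regular_at_mult rational_regular_at_power
  rational_regular_at_powi rational_regular_at_prod rational_regular_at_inverse
  rational_regular_at_sum

text \<open>A presentation of \<open>F\<close> by a finite family of monomials with possible repetitions suffices: terms with
the same monomial are collected, and regularity is preserved under finite sums.\<close>

lemma coeffwise_limitI:
  fixes \<iota> :: "'k::real_normed_field \<Rightarrow> 'a::comm_ring_1"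
  assumes \<iota>_add: "\<And>x y. \<iota> (x + y) = \<iota> x + \<iota> y"
    and T: "finite T" "\<And>X. X \<in> T \<Longrightarrow> set_mset (mon X) \<subseteq> I"
    and reg: "\<And>X. X \<in> T \<Longrightarrow> rational_regular_at (g X) a (c X)"
    and F: "\<And>q. F q = (\<Sum>X\<in>T. \<iota> (g X q) * (\<Prod>\<^sub># (image_mset A (mon X))))"
    and L: "L = (\<Sum>X\<in>T. \<iota> (c X) * (\<Prod>\<^sub># (image_mset A (mon X))))"
  shows "coeffwise_limit \<iota> I A F a L"
proof -
  have \<iota>_0: "\<iota> 0 = 0" using \<iota>_add[of 0 0] by simp
  have \<iota>_sum: "\<iota> (sum h U) = (\<Sum>u\<in>U. \<iota> (h u))" for h :: "'b \<Rightarrow> 'k" and U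
    by (induction U rule: infinite_finite_induct) (simp_all add: \<iota>_0 \<iota>_add)
  define fib where "fib \<mu> = {X\<in>T. mon X = \<mu>}" for \<mu>
  have group: "(\<Sum>X\<in>T. \<iota> (h X) * (\<Prod>\<^sub># (image_mset A (mon X))))
      = (\<Sum>\<mu>\<in>mon ` T. \<iota> (sum h (fib \<mu>)) * (\<Prod>\<^sub># (image_mset A \<mu>)))" for h
    by (subst sum.image_gen[OF T(1), of _ mon])
      (auto intro!: sum.cong simp: \<iota>_sum sum_distrib_right fib_def)
  have "rational_regular_at (\<lambda>q. \<Sum>X\<in>fib \<mu>. g X q) a (sum c (fib \<mu>))" for \<mu>
    by (rule rational_regular_at_sum) (simp add: reg fib_def)
  hence "\<forall>\<mu>. \<exists>N D. poly D a \<noteq> 0 \<and> sum c (fib \<mu>) = poly N a / poly D a \<and>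
     (\<forall>\<^sub>F q in at a. (\<Sum>X\<in>fib \<mu>. g X q) = poly N q / poly D q)"
    unfolding rational_regular_at_def by (rule allI)
  from choice[OF this] obtain N where "\<forall>\<mu>. \<exists>D. poly D a \<noteq> 0 \<and>
     sum c (fib \<mu>) = poly (N \<mu>) a / poly D a \<and>
     (\<forall>\<^sub>F q in at a. (\<Sum>X\<in>fib \<mu>. g X q) = poly (N \<mu>) q / poly D q)" ..
  from choice[OF this] obtain D where "\<forall>\<mu>. poly (D \<mu>) a \<noteq> 0 \<and>
     sum c (fib \<mu>) = poly (N \<mu>) a / poly (D \<mu>) a \<and>
     (\<forall>\<^sub>F q in at a. (\<Sum>X\<in>fib \<mu>. g X q) = poly (N \<mu>) q / poly (D \<mu>) q)" ..
  hence ND: "\<And>\<mu>. poly (D \<mu>) a \<noteq> 0"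
    "\<And>\<mu>. sum c (fib \<mu>) = poly (N \<mu>) a / poly (D \<mu>) a"
    "\<And>\<mu>. \<forall>\<^sub>F q in at a. (\<Sum>X\<in>fib \<mu>. g X q) = poly (N \<mu>) q / poly (D \<mu>) q"
    by simp_all
  show ?thesis
    unfolding coeffwise_limit_def
  proof (intro exI conjI ballI)
    show "finite (mon ` T)" using T(1) by simp
    show "set_mset \<mu> \<subseteq> I" if "\<mu> \<in> mon ` T" for \<mu> using that T(2) by blast
    show "D \<mu> \<noteq> 0" for \<mu> using ND(1)[of \<mu>] by auto
    show "((\<lambda>q. poly (N \<mu>) q / poly (D \<mu>) q) \<longlongrightarrow> sum c (fib \<mu>)) (at a)" for \<mu>
      unfolding ND(2) using ND(1) by (intro tendsto_divide tendsto_poly tendsto_ident_at)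
    have "\<forall>\<^sub>F q in at a. \<forall>\<mu>\<in>mon ` T. (\<Sum>X\<in>fib \<mu>. g X q) = poly (N \<mu>) q / poly (D \<mu>) q"
      using T(1) ND(3) by (intro eventually_ball_finite) auto
    thus "\<forall>\<^sub>F q in at a. F q = (\<Sum>\<mu>\<in>mon ` T. \<iota> (poly (N \<mu>) q / poly (D \<mu>) q) *
        (\<Prod>\<^sub># (image_mset A \<mu>)))"
      by eventually_elim (simp only: F group cong: sum.cong)
    show "L = (\<Sum>\<mu>\<in>mon ` T. \<iota> (sum c (fib \<mu>)) * (\<Prod>\<^sub># (image_mset A \<mu>)))"
      unfolding L group ..
  qed
qed

section \<open>The coefficients near 1\<close>

text \<open>For \<open>q \<noteq> 1\<close> the geometric sum gives \<open>(1 - q) / (1 - q ^ Suc k) = 1 / (1 + q + \<dots> + q ^ k)\<close>.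
This holds even where the geometric sum vanishes, both sides then being \<open>0\<close>.\<close>

lemma prefactor_regular_at_1:
  "rational_regular_at (\<lambda>q::'k::real_normed_field. (1 - q) ^ n / qpoch q q n) 1 (1 / fact n)"
proof (rule rational_regular_at_cong)
  have "rational_regular_at (\<lambda>q::'k. \<Prod>k<n. inverse (\<Sum>i<Suc k. q ^ i)) 1
     (\<Prod>k<n. inverse (\<Sum>i<Suc k. 1 ^ i))"
    by (intro rational_regular_at_intros) (simp del: of_nat_Suc)
  also have "(\<Prod>k<n. inverse (\<Sum>i<Suc k. 1 ^ i)) = (1 / fact n :: 'k)"
    by (induction n) (simp_all add: field_simps del: sum.lessThan_Suc of_nat_Suc)
  finally show "rational_regular_at (\<lambda>q::'k. \<Prod>k<n. inverse (\<Sum>i<Suc k. q ^ i)) 1 (1 / fact n)" .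
  have "(1 - q) ^ n / qpoch q q n = (\<Prod>k<n. inverse (\<Sum>i<Suc k. q ^ i))" if "q \<noteq> 1" for q :: 'k
  proof -
    have "(1 - q) ^ n / qpoch q q n = (\<Prod>k<n. (1 - q) / (1 - q * q ^ k))"
      by (simp add: qpoch_def prod_dividef)
    also have "\<dots> = (\<Prod>k<n. inverse (\<Sum>i<Suc k. q ^ i))"
    proof (rule prod.cong[OF refl])
      fix k
      have "1 - q * q ^ k = (1 - q) * (\<Sum>i<Suc k. q ^ i)"
        using one_diff_power_eq[of q "Suc k"] by simp
      thus "(1 - q) / (1 - q * q ^ k) = inverse (\<Sum>i<Suc k. q ^ i)"
        using that by (simp add: inverse_eq_divide)
    qed
    finally show ?thesis .
  qed
  thus "\<forall>\<^sub>F q::'k in at 1. (1 - q) ^ n / qpoch q q n = (\<Prod>k<n. inverse (\<Sum>i<Suc k. q ^ i))"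
    by (auto simp: eventually_at_filter)
qed

text \<open>This is the common value at \<open>q = 1\<close> of the \<open>2 * m\<close> kinds of factor in \<open>phi\<close>; the convention
\<open>0 ^ 0 = 1\<close> makes it the indicator of matrices without entries \<open>-1\<close>, up to sign.\<close>

definition limit_weight :: "nat \<Rightarrow> (nat \<Rightarrow> nat \<Rightarrow> int) \<Rightarrow> 'k::field" where
  "limit_weight n x = (-1) powi inv_number n x * 0 ^ neg_count n x"

lemma limit_weight_perm_matrix:
  assumes "p permutes {1..n}"
  shows "limit_weight n (perm_matrix n p) = of_int (sign p)"
  using sign_eq_minus_one_power_inversions[OF assms]
  by (simp add: limit_weight_def inv_number_perm_matrix[OF assms])

text \<open>At \<open>q = 1\<close> the factors for \<open>X r\<close> and for \<open>X (m + r)\<close> have the same form, so the two halves of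
the tuple combine into one product.\<close>

lemma phi_regular_at_1:
  "rational_regular_at (\<lambda>q::'k::real_normed_field. phi m n q X) 1
     (\<Prod>k=1..2*m. limit_weight n (X k))"
proof -
  have "rational_regular_at (\<lambda>q::'k. phi m n q X) 1
     (\<Prod>r=1..m. (- (1 ^ (r - 1))) powi inv_number n (X r)
       * (1 - 1 powi (- (int r - 1))) ^ neg_count n (X r)
       * (- (1 ^ r)) powi inv_number n (X (m + r))
       * (1 - 1 powi (- int r)) ^ neg_count n (X (m + r)))"
    unfolding phi_def by (intro rational_regular_at_intros) simp_all
  also have "(\<Prod>r=1..m. (- (1 ^ (r - 1))) powi inv_number n (X r)
       * (1 - 1 powi (- (int r - 1))) ^ neg_count n (X r)
       * (- (1 ^ r)) powi inv_number n (X (m + r))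
       * (1 - 1 powi (- int r)) ^ neg_count n (X (m + r)))
     = (\<Prod>r=1..m. limit_weight n (X r)) * (\<Prod>r=1..m. limit_weight n (X (m + r)) :: 'k)"
    by (simp add: limit_weight_def prod.distrib[symmetric] mult.assoc)
  also have "(\<Prod>r=1..m. limit_weight n (X (m + r))) = (\<Prod>k=m+1..m+m. limit_weight n (X k) :: 'k)"
    using prod.shift_bounds_cl_nat_ivl[of "\<lambda>k. limit_weight n (X k) :: 'k" 1 m m] by (simp add: add.commute)
  also have "(\<Prod>r=1..m. limit_weight n (X r)) * (\<Prod>k=m+1..m+m. limit_weight n (X k))
      = (\<Prod>k=1..2*m. limit_weight n (X k) :: 'k)"
    using prod.ub_add_nat[of 1 m "\<lambda>k. limit_weight n (X k) :: 'k" m] by (simp add: mult_2)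
  finally show ?thesis .
qed

section \<open>The limit of the hyperdeterminant\<close>

definition index_monomial ::
  "nat \<Rightarrow> nat \<Rightarrow> (nat \<Rightarrow> nat \<Rightarrow> nat \<Rightarrow> int) \<Rightarrow> nat list multiset" where
  "index_monomial m n X =
     image_mset (\<lambda>i. map (\<lambda>k. gen_perm n (X k) i) [1..<2*m+1]) (mset_set {1..n})"

lemma index_monomial_in_multi_indices:
  assumes "X \<in> {1..2*m} \<rightarrow>\<^sub>E Alt n"
  shows "set_mset (index_monomial m n X) \<subseteq> multi_indices m n"
proof -
  have "gen_perm n (X k) i \<in> {1..n}" if "k \<in> {1..2*m}" "i \<in> {1..n}" for k i
    using assms that by (intro gen_perm_in_range) auto
  thus ?thesis by (fastforce simp: index_monomial_def multi_indices_def simp del: upt_Suc)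
qed

lemma prod_mset_index_monomial:
  "\<Prod>\<^sub># (image_mset A (index_monomial m n X))
     = (\<Prod>i=1..n. A (map (\<lambda>k. gen_perm n (X k) i) [1..<2*m+1]))"
  by (simp add: index_monomial_def prod_unfold_prod_mset image_mset.compositionality o_def)

lemma bij_betw_PiE_compose:
  assumes "bij_betw h S T"
  shows "bij_betw (\<lambda>f. \<lambda>k\<in>K. h (f k)) (K \<rightarrow>\<^sub>E S) (K \<rightarrow>\<^sub>E T)"
proof (rule bij_betw_byWitness[where f' = "\<lambda>f. \<lambda>k\<in>K. inv_into S h (f k)"])
  have inv: "inv_into S h (h x) = x" if "x \<in> S" for x
    using assms that by (rule bij_betw_inv_into_left)
  have inv': "h (inv_into S h y) = y" "inv_into S h y \<in> S" if "y \<in> T" for y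
    using bij_betw_inv_into_right[OF assms that] bij_betwE[OF bij_betw_inv_into[OF assms]] that by auto
  show "\<forall>f\<in>K \<rightarrow>\<^sub>E S. (\<lambda>k\<in>K. inv_into S h ((\<lambda>k\<in>K. h (f k)) k)) = f"
  proof (intro ballI ext)
    fix f k assume "f \<in> K \<rightarrow>\<^sub>E S"
    thus "(\<lambda>k\<in>K. inv_into S h ((\<lambda>k\<in>K. h (f k)) k)) k = f k"
      using inv[of "f k"] PiE_mem[of f K "\<lambda>_. S" k] PiE_arb[of f K "\<lambda>_. S" k]
      by (cases "k \<in> K") simp_all
  qed
  show "\<forall>f\<in>K \<rightarrow>\<^sub>E T. (\<lambda>k\<in>K. h ((\<lambda>k\<in>K. inv_into S h (f k)) k)) = f"
  proof (intro ballI ext)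
    fix f k assume "f \<in> K \<rightarrow>\<^sub>E T"
    thus "(\<lambda>k\<in>K. h ((\<lambda>k\<in>K. inv_into S h (f k)) k)) k = f k"
      using inv'(1)[of "f k"] PiE_mem[of f K "\<lambda>_. T" k] PiE_arb[of f K "\<lambda>_. T" k]
      by (cases "k \<in> K") simp_all
  qed
  show "(\<lambda>f. \<lambda>k\<in>K. h (f k)) ` (K \<rightarrow>\<^sub>E S) \<subseteq> K \<rightarrow>\<^sub>E T"
    using bij_betwE[OF assms] by auto
  show "(\<lambda>f. \<lambda>k\<in>K. inv_into S h (f k)) ` (K \<rightarrow>\<^sub>E T) \<subseteq> K \<rightarrow>\<^sub>E S"
    using inv'(2) by (intro image_subsetI restrict_PiE_iff[THEN iffD2] ballI) (meson PiE_mem)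
qed

theorem proposition2p2:
  fixes m n :: nat
    and \<iota> :: "'k::real_normed_field \<Rightarrow> 'a::comm_ring_1"
    and A :: "nat list \<Rightarrow> 'a"
  assumes "m \<ge> 1" and "n \<ge> 1"
    and "\<iota> 1 = 1"
    and "\<And>x y. \<iota> (x + y) = \<iota> x + \<iota> y"
    and "\<And>x y. \<iota> (x * y) = \<iota> x * \<iota> y"
  shows "coeffwise_limit \<iota> (multi_indices m n) A
           (\<lambda>q. lambda_hyperdet \<iota> m n q A) 1 (hyperdet \<iota> m n A)"
proof -
  note \<iota>_1 = assms(3) and \<iota>_add = assms(4) and \<iota>_mult = assms(5)
  have \<iota>_0: "\<iota> 0 = 0" using \<iota>_add[of 0 0] by simp
  have \<iota>_minus: "\<iota> (- x) = - \<iota> x" for x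
    using \<iota>_add[of x "- x"] \<iota>_0 by (simp add: eq_neg_iff_add_eq_0 add.commute)
  have \<iota>_nat: "\<iota> (of_nat k) = of_nat k" for k
    by (induction k) (simp_all add: \<iota>_0 \<iota>_1 \<iota>_add)
  have \<iota>_int: "\<iota> (of_int z) = of_int z" for z
    by (cases z rule: int_cases2) (simp_all add: \<iota>_nat \<iota>_minus)
  define K where "K = {1..2*m}"
  define P where "P = {p. p permutes {1..n}}"
  define Alt0 where "Alt0 = {x\<in>Alt n. neg_count n x = 0}"
  define M where "M X = (\<Prod>i=1..n. A (map (\<lambda>k. gen_perm n (X k) i) [1..<2*m+1]))" for X
  define w :: "(nat \<Rightarrow> nat \<Rightarrow> nat \<Rightarrow> int) \<Rightarrow> 'k"
    where "w X = (\<Prod>k\<in>K. limit_weight n (X k))" for X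
  let ?PM = "\<lambda>\<sigma>. \<lambda>k\<in>K. perm_matrix n (\<sigma> k)"
  have fin: "finite (K \<rightarrow>\<^sub>E Alt n)"
    unfolding K_def by (intro finite_PiE finite_Alt) auto
  have term_eq: "\<iota> (w (?PM \<sigma>)) * M (?PM \<sigma>)
      = of_int (\<Prod>k=1..2*m. sign (\<sigma> k)) * (\<Prod>i=1..n. A (map (\<lambda>k. \<sigma> k i) [1..<2*m+1]))"
    if \<sigma>: "\<sigma> \<in> K \<rightarrow>\<^sub>E P" for \<sigma>
  proof -
    have perm: "\<sigma> k permutes {1..n}" if "k \<in> K" for k using \<sigma> that by (auto simp: P_def)
    have "w (?PM \<sigma>) = (\<Prod>k\<in>K. of_int (sign (\<sigma> k)))"
      unfolding w_def by (intro prod.cong refl) (simp add: limit_weight_perm_matrix[OF perm])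
    hence "w (?PM \<sigma>) = of_int (\<Prod>k=1..2*m. sign (\<sigma> k))" by (simp add: K_def)
    moreover have "M (?PM \<sigma>) = (\<Prod>i=1..n. A (map (\<lambda>k. \<sigma> k i) [1..<2*m+1]))"
      unfolding M_def
    proof (intro prod.cong refl arg_cong[where f = A] map_cong)
      fix i k assume "i \<in> {1..n}" "k \<in> set [1..<2*m+1]"
      moreover from this have "k \<in> K" by (auto simp: K_def)
      ultimately show "gen_perm n (?PM \<sigma> k) i = \<sigma> k i"
        using gen_perm_perm_matrix[OF perm] by simp
    qed
    ultimately show ?thesis by (simp only: \<iota>_int)
  qed
  have "hyperdet \<iota> m n A = \<iota> (1 / fact n) * (\<Sum>\<sigma>\<in>K \<rightarrow>\<^sub>E P. \<iota> (w (?PM \<sigma>)) * M (?PM \<sigma>))"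
    unfolding hyperdet_def K_def[symmetric] P_def[symmetric]
    using term_eq by (simp add: K_def)
  also have "(\<Sum>\<sigma>\<in>K \<rightarrow>\<^sub>E P. \<iota> (w (?PM \<sigma>)) * M (?PM \<sigma>)) = (\<Sum>X\<in>K \<rightarrow>\<^sub>E Alt0. \<iota> (w X) * M X)"
    by (rule sum.reindex_bij_betw, unfold Alt0_def P_def)
      (rule bij_betw_PiE_compose[OF bij_betw_perm_matrix])
  also have "\<dots> = (\<Sum>X\<in>K \<rightarrow>\<^sub>E Alt n. \<iota> (w X) * M X)"
  proof (rule sum.mono_neutral_left[OF fin])
    show "K \<rightarrow>\<^sub>E Alt0 \<subseteq> K \<rightarrow>\<^sub>E Alt n" by (rule PiE_mono) (auto simp: Alt0_def)
    \<comment> \<open>A single matrix with an entry \<open>-1\<close> makes the whole limiting weight vanish.\<close>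
    show "\<forall>X\<in>(K \<rightarrow>\<^sub>E Alt n) - (K \<rightarrow>\<^sub>E Alt0). \<iota> (w X) * M X = 0"
    proof
      fix X assume X: "X \<in> (K \<rightarrow>\<^sub>E Alt n) - (K \<rightarrow>\<^sub>E Alt0)"
      then obtain k where "k \<in> K" "neg_count n (X k) \<noteq> 0"
        by (auto simp: Alt0_def PiE_iff)
      hence "w X = 0" unfolding w_def limit_weight_def
        by (intro prod_zero bexI[of _ k]) (auto simp: K_def)
      thus "\<iota> (w X) * M X = 0" by (simp add: \<iota>_0)
    qed
  qed
  finally have L: "hyperdet \<iota> m n A = (\<Sum>X\<in>K \<rightarrow>\<^sub>E Alt n. \<iota> (1 / fact n * w X) *
      \<Prod>\<^sub># (image_mset A (index_monomial m n X)))"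
    by (simp only: sum_distrib_left \<iota>_mult mult.assoc prod_mset_index_monomial M_def)
  show ?thesis
  proof (rule coeffwise_limitI[OF \<iota>_add fin _ _ _ L])
    show "set_mset (index_monomial m n X) \<subseteq> multi_indices m n" if "X \<in> K \<rightarrow>\<^sub>E Alt n" for X
      using that unfolding K_def by (rule index_monomial_in_multi_indices)
    show "rational_regular_at (\<lambda>q. (1 - q) ^ n / qpoch q q n * phi m n q X) 1 (1 / fact n * w X)" for X
      unfolding w_def K_def
      by (intro rational_regular_at_mult prefactor_regular_at_1 phi_regular_at_1)
    show "lambda_hyperdet \<iota> m n q A = (\<Sum>X\<in>K \<rightarrow>\<^sub>E Alt n.
        \<iota> ((1 - q) ^ n / qpoch q q n * phi m n q X) *
        \<Prod>\<^sub># (image_mset A (index_monomial m n X)))" for q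
      unfolding lambda_hyperdet_def
      by (simp only: sum_distrib_left \<iota>_mult mult.assoc prod_mset_index_monomial K_def)
  qed
qed

end
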